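(* Let $X$ be a complex Banach space, let $(x_n)_{n\in\mathbb{N}}$ be a bounded sequence in $X$, and let $\varepsilon>0$. Suppose that $(x_n)$ admits $\varepsilon$-$\ell^1$-blocks. Then there is a subsequence $(x_{n_k})_k$ of $(x_n)$ such that, for every $x'\in X'$ with $\|x'\|=1$, the diameter of the set of accumulation points of the sequence $(x'(x_{n_k}))_k$ in $\mathbb{C}$ is at most $8\varepsilon/\sqrt{2}$.
   Context: $X'$ denotes the dual space of continuous linear functionals on $X$. Let $\mathbb{K}$ be the scalar field (here $\mathbb{K}=\mathbb{C}$). A bounded sequence $(x_n)$ in a Banach space over $\mathbb{K}$ is said to admit $\varepsilon$-$\ell^1$-blocks if for every infinite set $M\subset\mathbb{N}$ there are an $r\in\mathbb{N}$, scalars $a_1,\ldots,a_r\in\mathbb{K}$ with $\sum_{\rho=1}^r|a_\rho|=1$, and indices $i_1<\cdots<i_r$ in $M$ such that $\bigl\|\sum_{\rho=1}^r a_\rho x_{i_\rho}\bigr\|\le\varepsilon$. An accumulation point of a sequence of complex numbers means the limit of some subsequence. *)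

theory Defs
  imports "HOL-Analysis.Analysis"
begin

text \<open>HOL-Analysis provides real Banach spaces only. A complex Banach space is a real one whose
  scalar multiplication is the restriction of a complex one compatible with the norm.\<close>

class complex_normed_vector = real_normed_vector +
  fixes scaleC :: "complex \<Rightarrow> 'a \<Rightarrow> 'a"  (infixr "*\<^sub>C" 75)
  assumes scaleC_add_right: "a *\<^sub>C (x + y) = a *\<^sub>C x + a *\<^sub>C y"
    and scaleC_add_left: "(a + b) *\<^sub>C x = a *\<^sub>C x + b *\<^sub>C x"
    and scaleC_scaleC: "a *\<^sub>C (b *\<^sub>C x) = (a * b) *\<^sub>C x"
    and scaleC_one: "1 *\<^sub>C x = x"
    and scaleR_scaleC: "r *\<^sub>R x = complex_of_real r *\<^sub>C x"
    and norm_scaleC: "norm (a *\<^sub>C x) = cmod a * norm x"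

class complex_banach = complex_normed_vector + complete_space

instantiation complex :: complex_banach
begin

definition scaleC_complex :: "complex \<Rightarrow> complex \<Rightarrow> complex"
  where "scaleC_complex = (*)"

instance
  by standard
    (simp_all add: scaleC_complex_def algebra_simps norm_mult scaleR_conv_of_real)

end

lemma vector_space_scaleC:
  "vector_space (scaleC :: complex \<Rightarrow> 'a \<Rightarrow> 'a::complex_normed_vector)"
  by standard (simp_all add: scaleC_add_right scaleC_add_left scaleC_scaleC scaleC_one)

text \<open>The norm of an element of the dual space is its operator norm \<^const>\<open>onorm\<close>.\<close>

definition complex_dual :: "('a::complex_normed_vector \<Rightarrow> complex) set"
  where "complex_dual = {f. Vector_Spaces.linear (*\<^sub>C) (*) f \<and> continuous_on UNIV f}"

definition admits_l1_blocks :: "real \<Rightarrow> (nat \<Rightarrow> 'a::complex_normed_vector) \<Rightarrow> bool"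
  where "admits_l1_blocks \<epsilon> x \<longleftrightarrow>
    (\<forall>M::nat set. infinite M \<longrightarrow>
      (\<exists>(r::nat) (a::nat \<Rightarrow> complex) (i::nat \<Rightarrow> nat).
        (\<Sum>\<rho>=1..r. cmod (a \<rho>)) = 1 \<and>
        strict_mono_on {1..r} i \<and> i ` {1..r} \<subseteq> M \<and>
        norm (\<Sum>\<rho>=1..r. a \<rho> *\<^sub>C x (i \<rho>)) \<le> \<epsilon>))"

text \<open>Accumulation points of a sequence are limits of subsequences. They need not be limit points
  of its range: a value taken infinitely often counts.\<close>

definition accumulation_points :: "(nat \<Rightarrow> complex) \<Rightarrow> complex set"
  where "accumulation_points s =
    {z. \<exists>\<phi>::nat \<Rightarrow> nat. strict_mono \<phi> \<and> (s \<circ> \<phi>) \<longlonglongrightarrow> z}"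

end

theory Submission
  imports Defs
begin

text \<open>
  Suppose that two discs of radius \<open>\<eta> = \<epsilon>/4\<close> with centres \<open>p\<close>, \<open>q\<close> have the property that every
  infinite subset of some infinite set of indices contains, for some norm-one functional \<open>f\<close>,
  infinitely many \<open>n\<close> with \<open>f (x n)\<close> in the first disc and infinitely many with \<open>f (x n)\<close> in the
  second. Rosenthal's combinatorial argument (\<open>rich_imp_independent\<close>) then gives an infinite set
  \<open>M\<close> of indices on which the two discs are independent: for any disjoint finite \<open>A, B \<subseteq> M\<close> there
  is a norm-one functional mapping \<open>x n\<close> into the first disc for \<open>n \<in> A\<close> and into the second for
  \<open>n \<in> B\<close>.

  Take a normalised block \<open>y = \<Sum> a\<^sub>\<rho> x\<^sub>\<rho>\<close> in \<open>M\<close> with \<open>norm y \<le> \<epsilon>\<close>, and choose real signs \<open>s\<^sub>\<rho>\<close>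
  with \<open>cmod (\<Sum> s\<^sub>\<rho> a\<^sub>\<rho>) \<ge> 1/2\<close> (\<open>signed_sum_ge\<close>). Let \<open>f\<close> follow the sign pattern and \<open>g\<close> the
  opposite one. Up to an error of \<open>2\<eta>\<close> coming from the radii, \<open>f y - g y\<close> is
  \<open>(p - q) (\<Sum> s\<^sub>\<rho> a\<^sub>\<rho>)\<close>, while it has modulus at most \<open>2\<epsilon>\<close>. Hence
  \<open>cmod (p - q) \<le> 4\<epsilon> + 4\<eta> = 5\<epsilon>\<close> (\<open>rich_discs_close\<close>).

  All values \<open>f (x n)\<close> lie in a fixed disc of the plane, which is covered by finitely many discs of
  radius \<open>\<eta>\<close>. If the centres of two of them are further apart than \<open>5\<epsilon>\<close>, every infinite
  index set has an infinite subset on which no norm-one functional visits both discs infinitely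
  often; treating the finitely many pairs one after the other (\<open>avoid_finitely_many\<close>) produces the
  subsequence. Two accumulation points of the same sequence of values lie in two of the discs, so
  their distance is at most \<open>5\<epsilon> + 2\<eta> = 11\<epsilon>/2\<close>, which is less than \<open>8\<epsilon>/\<surd>2 = 4\<surd>2 \<epsilon>\<close>. The margin
  is what makes a single finite net sufficient.
\<close>

section \<open>Rosenthal's independence argument for pairs of index sets\<close>

definition splits :: "nat set \<times> nat set \<Rightarrow> nat set \<Rightarrow> bool"
  where "splits p N \<longleftrightarrow> infinite (fst p \<inter> N) \<and> infinite (snd p \<inter> N)"

text \<open>In the application each pair belongs to one functional: its components are the indices at which
  the functional takes values in the first and in the second of two discs.\<close>

definition rich :: "(nat set \<times> nat set) set \<Rightarrow> nat set \<Rightarrow> bool"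
  where "rich F N \<longleftrightarrow> (\<forall>M\<subseteq>N. infinite M \<longrightarrow> (\<exists>p\<in>F. splits p M))"

lemma rich_subset: "rich F N \<Longrightarrow> M \<subseteq> N \<Longrightarrow> rich F M"
  unfolding rich_def by blast

lemma splits_mono: "splits p M \<Longrightarrow> M \<subseteq> N \<Longrightarrow> splits p N"
  unfolding splits_def by (meson Int_mono infinite_super order_refl)

text \<open>If no \<open>n\<close> worked, one could pick indices \<open>n\<^sub>0, n\<^sub>1, \<dots>\<close> and shrinking sets \<open>M\<^sub>0 \<supseteq> M\<^sub>1 \<supseteq> \<dots>\<close>
  such that for each \<open>k\<close> some family and some side \<open>u\<close> fail: no pair \<open>p\<close> of the family with
  \<open>n\<^sub>k \<in> u p\<close> splits \<open>M\<^sub>k\<close>. The same family and side occur for infinitely many \<open>k\<close>. Richness gives a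
  pair of that family splitting the set of the corresponding \<open>n\<^sub>k\<close>; its side \<open>u\<close> contains one
  of these \<open>n\<^sub>k\<close>, and it splits \<open>M\<^sub>k\<close> because all indices chosen later lie in \<open>M\<^sub>k\<close>.\<close>

lemma rich_extend:
  assumes "finite G" and "infinite N" and rich: "\<And>F. F \<in> G \<Longrightarrow> rich F N"
  shows "\<exists>n\<in>N. \<exists>M\<subseteq>N. infinite M \<and> (\<forall>F\<in>G. \<forall>u\<in>{fst, snd}. rich {p\<in>F. n \<in> u p} M)"
proof (rule ccontr)
  assume contra: "\<not> ?thesis"
  define bad where "bad n M i \<longleftrightarrow> (\<forall>p\<in>fst i. n \<in> snd i p \<longrightarrow> \<not> splits p M)"
    for n M and i :: "(nat set \<times> nat set) set \<times> (nat set \<times> nat set \<Rightarrow> nat set)"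
  define I where "I = G \<times> {fst, snd :: nat set \<times> nat set \<Rightarrow> nat set}"
  have fail: "\<exists>M' i. M' \<subseteq> M \<and> infinite M' \<and> i \<in> I \<and> bad n M' i"
    if "n \<in> N" "M \<subseteq> N" "infinite M" for n M
  proof -
    have "\<not> (\<forall>F\<in>G. \<forall>u\<in>{fst, snd}. rich {p\<in>F. n \<in> u p} M)"
    proof
      assume "\<forall>F\<in>G. \<forall>u\<in>{fst, snd}. rich {p\<in>F. n \<in> u p} M"
      with that have "\<exists>n\<in>N. \<exists>M\<subseteq>N. infinite M \<and> (\<forall>F\<in>G. \<forall>u\<in>{fst, snd}. rich {p\<in>F. n \<in> u p} M)"
        by (intro bexI[of _ n] exI[of _ M] conjI)
      with contra show False by (rule notE)
    qed
    then have "\<exists>F\<in>G. \<exists>u\<in>{fst, snd}. \<not> rich {p\<in>F. n \<in> u p} M"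
      by simp
    then obtain F u where "F \<in> G" "u \<in> {fst, snd}" and nr: "\<not> rich {p\<in>F. n \<in> u p} M"
      by (elim bexE)
    from nr obtain M' where "M' \<subseteq> M" "infinite M'" "\<not> (\<exists>p\<in>{p\<in>F. n \<in> u p}. splits p M')"
      unfolding rich_def by blast
    then have "bad n M' (F, u)" unfolding bad_def by force
    moreover have "(F, u) \<in> I" using \<open>F \<in> G\<close> \<open>u \<in> {fst, snd}\<close> by (simp add: I_def)
    ultimately show ?thesis using \<open>M' \<subseteq> M\<close> \<open>infinite M'\<close> by blast
  qed
  \<comment> \<open>\<open>n\<close> is removed from \<open>M\<close> so that the chosen indices are distinct.\<close>
  define P where "P = (\<lambda>(k::nat) (n, M, i). n \<in> N \<and> M \<subseteq> N - {n} \<and> infinite M \<and> i \<in> I \<and> bad n M i)"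
  define Q where "Q = (\<lambda>(k::nat) (n::nat, M, i :: (nat set \<times> nat set) set \<times> (nat set \<times> nat set \<Rightarrow> nat set))
      (n'::nat, M', i' :: (nat set \<times> nat set) set \<times> (nat set \<times> nat set \<Rightarrow> nat set)).
      n' \<in> M \<and> M' \<subseteq> (M :: nat set))"
  have step: "\<exists>n M' i. n \<in> M \<and> M' \<subseteq> M \<and> n \<in> N \<and> M' \<subseteq> N - {n} \<and> infinite M' \<and> i \<in> I \<and> bad n M' i"
    if "M \<subseteq> N" "infinite M" for M
  proof -
    obtain n where n: "n \<in> M" using \<open>infinite M\<close> by (metis all_not_in_conv finite.emptyI)
    moreover obtain M' i where "M' \<subseteq> M - {n}" "infinite M'" "i \<in> I" "bad n M' i"
      using fail[of n "M - {n}"] n \<open>M \<subseteq> N\<close> \<open>infinite M\<close> by auto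
    ultimately have "n \<in> M \<and> M' \<subseteq> M \<and> n \<in> N \<and> M' \<subseteq> N - {n} \<and> infinite M' \<and> i \<in> I \<and> bad n M' i"
      using that(1) by blast
    then show ?thesis by blast
  qed
  have "\<exists>f. \<forall>k. P k (f k) \<and> Q k (f k) (f (Suc k))"
  proof (rule dependent_nat_choice)
    show "\<exists>y. P 0 y" using step[OF order_refl \<open>infinite N\<close>] by (auto simp: P_def)
    show "\<exists>z. P (Suc k) z \<and> Q k y z" if "P k y" for k y
    proof -
      obtain n0 M i0 where y: "y = (n0, M, i0)" by (cases y)
      have "M \<subseteq> N" "infinite M" using that by (auto simp: P_def y)
      from step[OF this] obtain n M' i where "n \<in> M" "M' \<subseteq> M" "n \<in> N" "M' \<subseteq> N - {n}"
        "infinite M'" "i \<in> I" "bad n M' i" by blast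
      then show ?thesis by (intro exI[of _ "(n, M', i)"]) (auto simp: P_def Q_def y)
    qed
  qed
  then obtain f where f: "\<And>k. P k (f k)" "\<And>k. Q k (f k) (f (Suc k))" by blast
  define n where "n = (\<lambda>k. fst (f k))"
  define M where "M = (\<lambda>k. fst (snd (f k)))"
  define i where "i = (\<lambda>k. snd (snd (f k)))"
  have P: "n k \<in> N" "n k \<notin> M k" "i k \<in> I" "bad (n k) (M k) (i k)" for k
    using f(1)[of k] by (auto simp: P_def n_def M_def i_def case_prod_beta)
  have Q: "n (Suc k) \<in> M k" "M (Suc k) \<subseteq> M k" for k
    using f(2)[of k] by (auto simp: Q_def n_def M_def case_prod_beta)
  have dec: "M l \<subseteq> M k" if "k \<le> l" for k l
    using Q(2) that by (rule lift_Suc_antimono_le)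
  have later: "n l \<in> M k" if "k < l" for k l
  proof -
    from that obtain j where "l = Suc j" "k \<le> j" by (cases l) auto
    then show ?thesis using Q(1)[of j] dec by blast
  qed
  have "inj n"
    by (rule linorder_injI) (metis later P(2))
  have "finite I" using \<open>finite G\<close> by (simp add: I_def)
  then have "finite (range i)" using P(3) by (meson finite_subset image_subsetI)
  then obtain k0 where inf: "infinite {k. i k = i k0}"
    using pigeonhole_infinite[of UNIV i] by auto
  obtain F u where i0: "i k0 = (F, u)" "F \<in> G" "u \<in> {fst, snd}"
    using P(3)[of k0] unfolding I_def by auto
  define S where "S = n ` {k. i k = i k0}"
  have "infinite S" unfolding S_def
    using inf \<open>inj n\<close> by (meson finite_imageD inj_on_subset subset_UNIV)
  moreover have "S \<subseteq> N" using P(1) by (auto simp: S_def)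
  ultimately obtain p where p: "p \<in> F" "splits p S"
    using rich[OF i0(2)] unfolding rich_def by blast
  have "infinite (u p \<inter> S)" using p(2) i0(3) by (auto simp: splits_def)
  then have "u p \<inter> S \<noteq> {}" by (metis finite.emptyI)
  then obtain k where k: "i k = i k0" "n k \<in> u p" unfolding S_def by blast
  \<comment> \<open>\<open>p\<close> therefore splits \<open>M\<^sub>k\<close> as well, since \<open>S\<close> differs from a subset of it by finitely many points.\<close>
  have "S \<subseteq> M k \<union> n ` {..k}" using later unfolding S_def by (metis (no_types, lifting)
      UnI1 UnI2 atMost_iff image_eqI image_subsetI not_le)
  then have "V \<inter> S \<subseteq> (V \<inter> M k) \<union> n ` {..k}" for V by blast
  then have "infinite (V \<inter> M k)" if "infinite (V \<inter> S)" for V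
    using that by (meson finite_UnI finite_atMost finite_imageI finite_subset)
  then have "splits p (M k)" using p(2) by (simp add: splits_def)
  moreover have "\<not> splits p (M k)" using P(4)[of k] k p(1) i0(1) by (simp add: bad_def)
  ultimately show False by blast
qed

text \<open>The set is built index by index. At each stage finitely many indices \<open>A\<close> have been selected such that for each of the
  \<open>2 ^ card A\<close> ways to divide them between the two sides, the pairs compatible with that division
  are still rich on the remaining set. Lemma \<open>rich_extend\<close>, applied to these finitely many
  families at once, provides the next index.\<close>

lemma rich_imp_independent:
  assumes "infinite N" and "rich F N"
  shows "\<exists>M\<subseteq>N. infinite M \<and>
    (\<forall>A B. finite A \<longrightarrow> A \<subseteq> M \<longrightarrow> finite B \<longrightarrow> B \<subseteq> M \<longrightarrow> A \<inter> B = {} \<longrightarrow>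
      (\<exists>p\<in>F. A \<subseteq> fst p \<and> B \<subseteq> snd p))"
proof -
  define R where "R A B = {p\<in>F. A \<subseteq> fst p \<and> B \<subseteq> snd p}" for A B
  define P where "P = (\<lambda>(k::nat) (A, N'). finite A \<and> card A = k \<and> A \<subseteq> N \<and> infinite N' \<and> N' \<subseteq> N - A \<and>
    (\<forall>A'\<subseteq>A. rich (R A' (A - A')) N'))"
  define Q where "Q = (\<lambda>(k::nat) (A::nat set, N1::nat set) (A'::nat set, N2::nat set). A \<subseteq> A')"
  have "\<exists>f. \<forall>k. P k (f k) \<and> Q k (f k) (f (Suc k))"
  proof (rule dependent_nat_choice)
    show "\<exists>y. P 0 y"
      using assms by (intro exI[of _ "({}, N)"]) (simp add: P_def R_def)
    show "\<exists>z. P (Suc k) z \<and> Q k y z" if "P k y" for k y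
    proof -
      obtain A N' where y: "y = (A, N')" by (cases y)
      have A: "finite A" "card A = k" "A \<subseteq> N" "infinite N'" "N' \<subseteq> N - A"
        and rich: "\<And>A'. A' \<subseteq> A \<Longrightarrow> rich (R A' (A - A')) N'"
        using that by (auto simp: P_def y)
      define G where "G = (\<lambda>A'. R A' (A - A')) ` Pow A"
      have "\<exists>n\<in>N'. \<exists>M\<subseteq>N'. infinite M \<and> (\<forall>F\<in>G. \<forall>u\<in>{fst, snd}. rich {p\<in>F. n \<in> u p} M)"
        by (rule rich_extend) (use A rich in \<open>auto simp: G_def\<close>)
      then obtain n M where nM: "n \<in> N'" "M \<subseteq> N'" "infinite M"
        and ext: "\<And>A' u. A' \<subseteq> A \<Longrightarrow> u \<in> {fst, snd} \<Longrightarrow> rich {p\<in>R A' (A - A'). n \<in> u p} M"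
        unfolding G_def by blast
      have "rich (R A' (insert n A - A')) (M - {n})" if "A' \<subseteq> insert n A" for A'
      proof (cases "n \<in> A'")
        case True
        have "A' - {n} \<subseteq> A" using that by blast
        moreover have "{p\<in>R (A' - {n}) (A - (A' - {n})). n \<in> fst p} = R A' (insert n A - A')"
          using True nM(1) A(5) by (auto simp: R_def)
        ultimately show ?thesis using ext[of "A' - {n}" fst] rich_subset by fastforce
      next
        case False
        then have "A' \<subseteq> A" using that by blast
        moreover have "{p\<in>R A' (A - A'). n \<in> snd p} = R A' (insert n A - A')"
          using False by (auto simp: R_def)
        ultimately show ?thesis using ext[of A' snd] rich_subset by fastforce
      qed
      moreover have "card (insert n A) = Suc k" using A nM(1) by (metis Diff_iff card_insert_disjoint subsetD)
      ultimately have "P (Suc k) (insert n A, M - {n})"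
        using A nM by (auto simp: P_def)
      then show ?thesis by (intro exI[of _ "(insert n A, M - {n})"]) (auto simp: Q_def y)
    qed
  qed
  then obtain f where f: "\<And>k. P k (f k)" "\<And>k. Q k (f k) (f (Suc k))" by blast
  define A where "A = (\<lambda>k. fst (f k))"
  have A: "finite (A k)" "card (A k) = k" "A k \<subseteq> N" for k
    using f(1)[of k] by (auto simp: P_def A_def case_prod_beta)
  have step: "A k \<subseteq> A (Suc k)" for k
    using f(2)[of k] by (simp add: Q_def A_def case_prod_beta)
  have mono: "A k \<subseteq> A l" if "k \<le> l" for k l
    using step that by (rule lift_Suc_mono_le)
  have ne: "\<exists>p. p \<in> R A' (A k - A')" if "A' \<subseteq> A k" for A' k
    using f(1)[of k] that unfolding P_def A_def rich_def case_prod_beta by blast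
  have fin_sub: "\<exists>k. C \<subseteq> A k" if "finite C" "C \<subseteq> (\<Union>k. A k)" for C
    using that
  proof (induction C)
    case (insert c C)
    then obtain k l where "C \<subseteq> A k" "c \<in> A l" by blast
    then have "insert c C \<subseteq> A (max k l)" using mono[of k "max k l"] mono[of l "max k l"] by auto
    then show ?case by blast
  qed simp
  show ?thesis
  proof (intro exI[of _ "\<Union>k. A k"] conjI allI impI)
    show "(\<Union>k. A k) \<subseteq> N" using A by blast
    show "infinite (\<Union>k. A k)"
    proof
      assume fin: "finite (\<Union>k. A k)"
      have "k \<le> card (\<Union>k. A k)" for k
        using card_mono[OF fin, of "A k"] A(2) by auto
      then show False using not_less_eq_eq by blast
    qed
    fix B C assume BC: "finite B" "B \<subseteq> (\<Union>k. A k)" "finite C" "C \<subseteq> (\<Union>k. A k)" "B \<inter> C = {}"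
    then obtain k where k: "B \<union> C \<subseteq> A k" using fin_sub[of "B \<union> C"] by auto
    then obtain p where "p \<in> R B (A k - B)" using ne[of B k] by auto
    then show "\<exists>p\<in>F. B \<subseteq> fst p \<and> C \<subseteq> snd p" using k BC(5) unfolding R_def by blast
  qed
qed

text \<open>Each family that is not rich on the set reached so far yields an infinite subset split by none
  of its pairs. Shrinking the set further preserves this, so the families can be handled in turn.\<close>

lemma avoid_finitely_many:
  assumes "finite \<F>" and "infinite N"
    and "\<And>F M. F \<in> \<F> \<Longrightarrow> infinite M \<Longrightarrow> \<not> rich F M"
  shows "\<exists>M\<subseteq>N. infinite M \<and> (\<forall>F\<in>\<F>. \<forall>p\<in>F. \<not> splits p M)"
  using assms(1,3)
proof (induction \<F>)
  case empty
  then show ?case using assms(2) by blast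
next
  case (insert F \<F>)
  have "\<exists>M\<subseteq>N. infinite M \<and> (\<forall>F\<in>\<F>. \<forall>p\<in>F. \<not> splits p M)"
    using insert.prems by (intro insert.IH) simp
  then obtain M where M: "M \<subseteq> N" "infinite M" "\<forall>F\<in>\<F>. \<forall>p\<in>F. \<not> splits p M" by blast
  have "\<not> rich F M" using insert.prems M(2) by simp
  then obtain M' where M': "M' \<subseteq> M" "infinite M'" "\<forall>p\<in>F. \<not> splits p M'"
    unfolding rich_def by blast
  have "\<forall>F'\<in>insert F \<F>. \<forall>p\<in>F'. \<not> splits p M'"
    using M(3) M'(3) splits_mono[OF _ M'(1)] by blast
  then show ?case using M'(1,2) M(1) by (intro exI[of _ M']) simp
qed

section \<open>Signs for complex coefficients\<close>

text \<open>Give each coefficient the sign of its real part, or each the sign of its imaginary part. Since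
  \<open>cmod z \<le> \<bar>Re z\<bar> + \<bar>Im z\<bar>\<close>, the real part of the first signed sum or the imaginary part of the
  second one accounts for at least half of the total.\<close>

lemma signed_sum_ge:
  fixes a :: "'i \<Rightarrow> complex"
  shows "\<exists>s. (\<forall>i. s i = 1 \<or> s i = -1) \<and>
    (\<Sum>i\<in>I. cmod (a i)) \<le> 2 * cmod (\<Sum>i\<in>I. complex_of_real (s i) * a i)"
proof -
  define X where "X = (\<Sum>i\<in>I. \<bar>Re (a i)\<bar>)"
  define Y where "Y = (\<Sum>i\<in>I. \<bar>Im (a i)\<bar>)"
  obtain s where s: "\<And>i. s i = 1 \<or> s i = (-1::real)"
    and max: "max X Y \<le> cmod (\<Sum>i\<in>I. complex_of_real (s i) * a i)"
  proof (cases "Y \<le> X")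
    case True
    define s where "s i = (if Re (a i) \<ge> 0 then 1 else -1 :: real)" for i
    have "X = Re (\<Sum>i\<in>I. complex_of_real (s i) * a i)"
      unfolding X_def by (auto simp: s_def intro!: sum.cong)
    then have "max X Y \<le> cmod (\<Sum>i\<in>I. complex_of_real (s i) * a i)"
      using True complex_Re_le_cmod[of "\<Sum>i\<in>I. complex_of_real (s i) * a i"] by simp
    then show ?thesis by (rule that[rotated]) (simp add: s_def)
  next
    case False
    define s where "s i = (if Im (a i) \<ge> 0 then 1 else -1 :: real)" for i
    have "Y = Im (\<Sum>i\<in>I. complex_of_real (s i) * a i)"
      unfolding Y_def by (auto simp: s_def intro!: sum.cong)
    then have "max X Y \<le> cmod (\<Sum>i\<in>I. complex_of_real (s i) * a i)"
      using False abs_Im_le_cmod[of "\<Sum>i\<in>I. complex_of_real (s i) * a i"] by simp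
    then show ?thesis by (rule that[rotated]) (simp add: s_def)
  qed
  have "(\<Sum>i\<in>I. cmod (a i)) \<le> (\<Sum>i\<in>I. \<bar>Re (a i)\<bar> + \<bar>Im (a i)\<bar>)"
    by (intro sum_mono cmod_le)
  also have "\<dots> = X + Y" by (simp add: X_def Y_def sum.distrib)
  also have "\<dots> \<le> 2 * cmod (\<Sum>i\<in>I. complex_of_real (s i) * a i)" using max by simp
  finally show ?thesis using s by blast
qed

section \<open>Functionals on blocks\<close>

lemma complex_dual_combination:
  assumes "f \<in> complex_dual"
  shows "f (\<Sum>i\<in>I. a i *\<^sub>C x i) = (\<Sum>i\<in>I. a i * f (x i))"
proof -
  interpret Vector_Spaces.linear "(*\<^sub>C)" "(*)" f
    using assms by (simp add: complex_dual_def)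
  show ?thesis by (simp add: sum scale)
qed

text \<open>Boundedness has to be known before \<^const>\<open>onorm\<close> can be used as a bound: for an
  unbounded functional it is the supremum of an unbounded set of reals and says nothing.\<close>

lemma complex_dual_bounded_linear:
  fixes f :: "'a::complex_normed_vector \<Rightarrow> complex"
  assumes "f \<in> complex_dual"
  shows "bounded_linear f"
proof -
  interpret Vector_Spaces.linear "(*\<^sub>C)" "(*)" f
    using assms by (simp add: complex_dual_def)
  have scaleR: "f (r *\<^sub>R v) = r *\<^sub>R f v" for r v
    by (simp add: scaleR_scaleC[of r v] scale scaleR_conv_of_real)
  have "isCont f 0"
    using assms by (simp add: complex_dual_def continuous_on_eq_continuous_at)
  then obtain d where "d > 0" and d: "\<And>v. norm v < d \<Longrightarrow> cmod (f v) < 1"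
    unfolding continuous_at_eps_delta by (auto simp: dist_norm dest!: spec[of _ "1::real"])
  \<comment> \<open>Any \<open>v \<noteq> 0\<close> can be rescaled to norm \<open>d / 2\<close>, whence the constant \<open>2 / d\<close>.\<close>
  show ?thesis
  proof (rule bounded_linear_intro[where K = "2 / d"])
    fix v
    show "cmod (f v) \<le> norm v * (2 / d)"
    proof (cases "v = 0")
      case False
      define c where "c = d / (2 * norm v)"
      have "c > 0" using \<open>d > 0\<close> False by (simp add: c_def)
      have "norm (c *\<^sub>R v) < d" using \<open>d > 0\<close> False by (simp add: c_def)
      from d[OF this] have "c * cmod (f v) < 1" using \<open>c > 0\<close> by (simp add: scaleR)
      then show ?thesis using \<open>d > 0\<close> False by (simp add: c_def field_simps)
    qed simp
  qed (simp_all add: add scaleR)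
qed

definition visits ::
  "(nat \<Rightarrow> 'a::complex_normed_vector) \<Rightarrow> real \<Rightarrow> complex \<Rightarrow> complex \<Rightarrow> (nat set \<times> nat set) set"
  where "visits x \<eta> p q =
    {({n. f (x n) \<in> ball p \<eta>}, {n. f (x n) \<in> ball q \<eta>}) |f. f \<in> complex_dual \<and> onorm f = 1}"

text \<open>Two functionals with opposite patterns differ on the \<open>\<rho>\<close>-th term of the block by
  \<open>s\<^sub>\<rho> (p - q)\<close>, up to \<open>2\<eta>\<close>; so their difference at the block is \<open>(p - q) (\<Sum> s\<^sub>\<rho> a\<^sub>\<rho>)\<close> up to
  \<open>2\<eta>\<close>. The blocks need not have bounded length, which is why independence on all finite
  subsets of one infinite set is required.\<close>

lemma rich_discs_close:
  fixes x :: "nat \<Rightarrow> 'a::complex_normed_vector"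
  assumes blocks: "admits_l1_blocks \<epsilon> x" and "infinite N" and "rich (visits x \<eta> p q) N"
  shows "cmod (p - q) \<le> 2 * (2 * \<epsilon> + 2 * \<eta>)"
proof -
  obtain M where M: "infinite M"
    and indep: "\<And>A B. finite A \<Longrightarrow> A \<subseteq> M \<Longrightarrow> finite B \<Longrightarrow> B \<subseteq> M \<Longrightarrow> A \<inter> B = {} \<Longrightarrow>
      \<exists>p'\<in>visits x \<eta> p q. A \<subseteq> fst p' \<and> B \<subseteq> snd p'"
    using rich_imp_independent[OF assms(2,3)] by metis
  obtain r :: nat and a :: "nat \<Rightarrow> complex" and i :: "nat \<Rightarrow> nat"
    where a: "(\<Sum>\<rho>=1..r. cmod (a \<rho>)) = 1" and i: "strict_mono_on {1..r} i"
    and iM: "i ` {1..r} \<subseteq> M" and small: "norm (\<Sum>\<rho>=1..r. a \<rho> *\<^sub>C x (i \<rho>)) \<le> \<epsilon>"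
    using blocks M unfolding admits_l1_blocks_def by blast
  define y where "y = (\<Sum>\<rho>=1..r. a \<rho> *\<^sub>C x (i \<rho>))"
  obtain s where s: "\<And>\<rho>. s \<rho> = 1 \<or> s \<rho> = (-1::real)"
    and ge: "1 \<le> 2 * cmod (\<Sum>\<rho>=1..r. complex_of_real (s \<rho>) * a \<rho>)"
    using signed_sum_ge[of a "{1..r}"] a by metis
  define A where "A = i ` {\<rho>\<in>{1..r}. s \<rho> = 1}"
  define B where "B = i ` {\<rho>\<in>{1..r}. s \<rho> = -1}"
  have AB: "finite A" "A \<subseteq> M" "finite B" "B \<subseteq> M" using iM by (auto simp: A_def B_def)
  have disj: "A \<inter> B = {}"
    using strict_mono_on_imp_inj_on[OF i] unfolding A_def B_def
    by (subst inj_on_image_Int[symmetric]) auto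
  obtain f where f: "f \<in> complex_dual" "onorm f = 1"
    and fA: "\<And>n. n \<in> A \<Longrightarrow> f (x n) \<in> ball p \<eta>" and fB: "\<And>n. n \<in> B \<Longrightarrow> f (x n) \<in> ball q \<eta>"
    using indep[OF AB disj] by (auto simp: visits_def subset_iff)
  have disj': "B \<inter> A = {}" using disj by blast
  obtain g where g: "g \<in> complex_dual" "onorm g = 1"
    and gB: "\<And>n. n \<in> B \<Longrightarrow> g (x n) \<in> ball p \<eta>" and gA: "\<And>n. n \<in> A \<Longrightarrow> g (x n) \<in> ball q \<eta>"
    using indep[OF AB(3,4,1,2) disj'] by (auto simp: visits_def subset_iff)
  have le: "cmod (h y) \<le> \<epsilon>" if "h \<in> complex_dual" "onorm h = 1" for h
    using onorm[OF complex_dual_bounded_linear[OF that(1)], of y] that(2) small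
    by (simp add: y_def)
  define e where "e = (\<lambda>\<rho>. f (x (i \<rho>)) - g (x (i \<rho>)) - complex_of_real (s \<rho>) * (p - q))"
  have e: "cmod (e \<rho>) \<le> 2 * \<eta>" if "\<rho> \<in> {1..r}" for \<rho>
  proof (cases "s \<rho> = 1")
    case True
    then have "i \<rho> \<in> A" using that by (auto simp: A_def)
    from fA[OF this] gA[OF this]
    have "cmod (f (x (i \<rho>)) - p) < \<eta>" "cmod (g (x (i \<rho>)) - q) < \<eta>"
      by (simp_all add: dist_norm norm_minus_commute)
    moreover have "e \<rho> = (f (x (i \<rho>)) - p) - (g (x (i \<rho>)) - q)" using True by (simp add: e_def)
    ultimately show ?thesis using norm_triangle_ineq4[of "f (x (i \<rho>)) - p" "g (x (i \<rho>)) - q"] by simp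
  next
    case False
    then have "s \<rho> = -1" using s by blast
    then have "i \<rho> \<in> B" using that by (auto simp: B_def)
    from fB[OF this] gB[OF this]
    have "cmod (f (x (i \<rho>)) - q) < \<eta>" "cmod (g (x (i \<rho>)) - p) < \<eta>"
      by (simp_all add: dist_norm norm_minus_commute)
    moreover have "e \<rho> = (f (x (i \<rho>)) - q) - (g (x (i \<rho>)) - p)"
      using \<open>s \<rho> = -1\<close> by (simp add: e_def)
    ultimately show ?thesis using norm_triangle_ineq4[of "f (x (i \<rho>)) - q" "g (x (i \<rho>)) - p"] by simp
  qed
  have "cmod (\<Sum>\<rho>=1..r. a \<rho> * e \<rho>) \<le> (\<Sum>\<rho>=1..r. cmod (a \<rho>) * (2 * \<eta>))"
    by (rule sum_norm_le) (simp add: norm_mult mult_left_mono e)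
  also have "\<dots> = 2 * \<eta>" using a by (simp flip: sum_distrib_right)
  finally have err: "cmod (\<Sum>\<rho>=1..r. a \<rho> * e \<rho>) \<le> 2 * \<eta>" .
  have "f y - g y = (\<Sum>\<rho>=1..r. a \<rho> * (f (x (i \<rho>)) - g (x (i \<rho>))))"
    unfolding y_def complex_dual_combination[OF f(1)] complex_dual_combination[OF g(1)]
    by (simp add: sum_subtractf right_diff_distrib)
  also have "\<dots> = (\<Sum>\<rho>=1..r. (p - q) * (complex_of_real (s \<rho>) * a \<rho>) + a \<rho> * e \<rho>)"
    by (intro sum.cong) (simp_all add: e_def algebra_simps)
  also have "\<dots> = (p - q) * (\<Sum>\<rho>=1..r. complex_of_real (s \<rho>) * a \<rho>) + (\<Sum>\<rho>=1..r. a \<rho> * e \<rho>)"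
    by (simp add: sum.distrib sum_distrib_left)
  finally have "(p - q) * (\<Sum>\<rho>=1..r. complex_of_real (s \<rho>) * a \<rho>) =
      (f y - g y) - (\<Sum>\<rho>=1..r. a \<rho> * e \<rho>)" by simp
  then have "cmod (p - q) * cmod (\<Sum>\<rho>=1..r. complex_of_real (s \<rho>) * a \<rho>) \<le>
      cmod (f y) + cmod (g y) + cmod (\<Sum>\<rho>=1..r. a \<rho> * e \<rho>)"
    by (metis add_right_mono norm_mult norm_triangle_ineq4 order_trans)
  also have "\<dots> \<le> 2 * \<epsilon> + 2 * \<eta>" using le[OF f] le[OF g] err by simp
  finally have main: "cmod (p - q) * cmod (\<Sum>\<rho>=1..r. complex_of_real (s \<rho>) * a \<rho>) \<le> 2 * \<epsilon> + 2 * \<eta>" .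
  have "cmod (p - q) * 1 \<le> cmod (p - q) * (2 * cmod (\<Sum>\<rho>=1..r. complex_of_real (s \<rho>) * a \<rho>))"
    by (rule mult_left_mono[OF ge]) simp
  also have "\<dots> = 2 * (cmod (p - q) * cmod (\<Sum>\<rho>=1..r. complex_of_real (s \<rho>) * a \<rho>))" by simp
  also have "\<dots> \<le> 2 * (2 * \<epsilon> + 2 * \<eta>)" using main by (rule mult_left_mono) simp
  finally show ?thesis by simp
qed

section \<open>Accumulation points\<close>

lemma accumulation_points_subset_closed:
  assumes "\<And>k. s k \<in> C" and "closed C"
  shows "accumulation_points s \<subseteq> C"
proof
  fix z assume "z \<in> accumulation_points s"
  then obtain \<phi> where "(s \<circ> \<phi>) \<longlonglongrightarrow> z" by (auto simp: accumulation_points_def)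
  then show "z \<in> C" using closed_sequentially[OF assms(2), of "s \<circ> \<phi>"] assms(1) by simp
qed

lemma infinite_indices_near_accumulation_point:
  assumes "z \<in> accumulation_points s" and "open U" and "z \<in> U"
  shows "infinite {k. s k \<in> U}"
proof -
  obtain \<phi> where "strict_mono \<phi>" and lim: "(s \<circ> \<phi>) \<longlonglongrightarrow> z"
    using assms(1) by (auto simp: accumulation_points_def)
  obtain K where K: "\<And>k. k \<ge> K \<Longrightarrow> s (\<phi> k) \<in> U"
    using topological_tendstoD[OF lim assms(2,3)] by (auto simp: eventually_sequentially)
  have "infinite (\<phi> ` {K..})"
    using finite_image_iff[OF strict_mono_imp_inj_on[OF \<open>strict_mono \<phi>\<close>, of "{K..}"]]
    by (simp add: infinite_Ici)
  then show ?thesis by (rule infinite_super[rotated]) (use K in auto)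
qed

theorem theorem3p3:
  fixes x :: "nat \<Rightarrow> 'a::complex_banach" and \<epsilon> :: real
  assumes "Bseq x"
    and "\<epsilon> > 0"
    and "admits_l1_blocks \<epsilon> x"
  shows "\<exists>n::nat \<Rightarrow> nat. strict_mono n \<and>
    (\<forall>x'\<in>complex_dual. onorm x' = 1 \<longrightarrow>
      diameter (accumulation_points (\<lambda>k. x' (x (n k)))) \<le> 8 * \<epsilon> / sqrt 2)"
proof -
  obtain K where K: "\<And>n. norm (x n) \<le> K" using \<open>Bseq x\<close> by (auto simp: Bseq_def)
  \<comment> \<open>Chosen so that \<open>4\<epsilon> + 4\<eta> + 2\<eta> < 4\<surd>2 \<epsilon>\<close>.\<close>
  define \<eta> where "\<eta> = \<epsilon> / 4"
  have "\<eta> > 0" using \<open>\<epsilon> > 0\<close> by (simp add: \<eta>_def)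
  obtain C where "finite C" and cover: "cball (0::complex) K \<subseteq> (\<Union>c\<in>C. ball c \<eta>)"
    using seq_compact_imp_totally_bounded[of "cball (0::complex) K"] \<open>\<eta> > 0\<close>
    by (metis compact_cball compact_imp_seq_compact)
  define \<F> where "\<F> = (\<lambda>(p, q). visits x \<eta> p q) `
    {(p, q)\<in>C \<times> C. cmod (p - q) > 2 * (2 * \<epsilon> + 2 * \<eta>)}"
  have "finite \<F>" unfolding \<F>_def
    by (intro finite_imageI finite_subset[OF _ finite_cartesian_product[OF \<open>finite C\<close> \<open>finite C\<close>]]) auto
  moreover have "\<not> rich F M" if "F \<in> \<F>" "infinite M" for F M
    using that rich_discs_close[OF assms(3) that(2)] unfolding \<F>_def by fastforce
  ultimately obtain N where "infinite N"
    and N: "\<And>F p. F \<in> \<F> \<Longrightarrow> p \<in> F \<Longrightarrow> \<not> splits p N"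
    using avoid_finitely_many[of \<F> UNIV] infinite_UNIV_nat by metis
  define n where "n = enumerate N"
  have n: "strict_mono n" "range n = N"
    using \<open>infinite N\<close> by (simp_all add: n_def strict_mono_enumerate range_enumerate)
  show ?thesis
  proof (intro exI[of _ n] conjI ballI impI n(1))
    fix f :: "'a \<Rightarrow> complex" assume f: "f \<in> complex_dual" "onorm f = 1"
    define s where "s = (\<lambda>k. f (x (n k)))"
    have "cmod (f (x m)) \<le> K" for m
      using onorm[OF complex_dual_bounded_linear[OF f(1)], of "x m"] f(2) K[of m] by simp
    then have sub: "accumulation_points s \<subseteq> cball 0 K"
      by (intro accumulation_points_subset_closed) (auto simp: s_def)
    have inf: "infinite ({m. f (x m) \<in> U} \<inter> N)"
      if "z \<in> accumulation_points s" "open U" "z \<in> U" for z U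
    proof -
      have "infinite (n ` {k. s k \<in> U})"
        using infinite_indices_near_accumulation_point[OF that]
        by (simp add: finite_image_iff[OF strict_mono_imp_inj_on[OF n(1)]])
      then show ?thesis by (rule infinite_super[rotated]) (use n(2) in \<open>auto simp: s_def\<close>)
    qed
    have close: "cmod (z - w) \<le> 8 * \<epsilon> / sqrt 2"
      if z: "z \<in> accumulation_points s" and w: "w \<in> accumulation_points s" for z w
    proof -
      obtain p q where pq: "p \<in> C" "q \<in> C" "z \<in> ball p \<eta>" "w \<in> ball q \<eta>"
        using z w sub cover by blast
      have "splits ({n. f (x n) \<in> ball p \<eta>}, {n. f (x n) \<in> ball q \<eta>}) N"
        using inf[OF z _ pq(3)] inf[OF w _ pq(4)] by (simp add: splits_def)
      moreover have "({n. f (x n) \<in> ball p \<eta>}, {n. f (x n) \<in> ball q \<eta>}) \<in> visits x \<eta> p q"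
        using f by (auto simp: visits_def)
      ultimately have "visits x \<eta> p q \<notin> \<F>" using N by blast
      then have pq': "cmod (p - q) \<le> 2 * (2 * \<epsilon> + 2 * \<eta>)"
        using pq(1,2) by (fastforce simp: \<F>_def)
      have "cmod (z - w) \<le> cmod (p - q) + 2 * \<eta>"
        using pq(3,4) dist_triangle[of z w p] dist_triangle[of p w q]
        by (simp add: dist_norm norm_minus_commute)
      also have "\<dots> \<le> (11 / 2) * \<epsilon>" using pq' by (simp add: \<eta>_def)
      also have "\<dots> \<le> (4 * sqrt 2) * \<epsilon>"
      proof (rule mult_right_mono)
        have "11 / 8 \<le> sqrt 2" by (rule real_le_rsqrt) (simp add: power2_eq_square)
        then show "11 / 2 \<le> 4 * sqrt 2" by simp
      qed (use \<open>\<epsilon> > 0\<close> in simp)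
      also have "\<dots> = 8 * \<epsilon> / sqrt 2" by (simp add: field_simps)
      finally show ?thesis .
    qed
    show "diameter (accumulation_points (\<lambda>k. f (x (n k)))) \<le> 8 * \<epsilon> / sqrt 2"
      using close \<open>\<epsilon> > 0\<close> unfolding s_def by (intro diameter_le) auto
  qed
qed

end
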